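(* Let $K=\mathbb{Q}(\tau)$ with $\tau^2=-3$, let $L_1,\dots,L_{24}$ be the $24$ lines in $\mathbb{P}^3_K$ listed in the context (they lie on the quartic $x_0^4-x_0x_1^3-x_2^4+x_2x_3^3=0$), and let $D=\sum_{j=1}^{24}L_j$. The singular locus of $D$ consists precisely of the following $32$ points $p$, each displayed with a triple of line labels $(j,k,l)$: 1. $(1,5,6)$: $[1:0:1:0]$ 2. $(1,7,10)$: $[1:-2:1:-2]$ 3. $(1,8,12)$: $[1:1+\tau:1:1+\tau]$ 4. $(1,9,11)$: $[1:1-\tau:1:1-\tau]$ 5. $(2,3,4)$: $[1:0:-1:0]$ 6. $(2,19,23)$: $[1:1+\tau:-1:-1-\tau]$ 7. $(2,20,22)$: $[1:1-\tau:-1:-1+\tau]$ 8. $(2,21,24)$: $[1:-2:-1:2]$ 9. $(3,7,14)$: $[1:1-\tau:-1:-1-\tau]$ 10. $(3,8,13)$: $[1:-2:-1:-1+\tau]$ 11. $(3,9,15)$: $[1:1+\tau:-1:2]$ 12. $(4,10,17)$: $[1:1+\tau:-1:-1+\tau]$ 13. $(4,11,16)$: $[1:-2:-1:-1-\tau]$ 14. $(4,12,18)$: $[1:1-\tau:-1:2]$ 15. $(5,13,19)$: $[1:1-\tau:1:-2]$ 16. $(5,14,21)$: $[1:1+\tau:1:1-\tau]$ 17. $(5,15,20)$: $[1:-2:1:1+\tau]$ 18. $(6,16,22)$: $[1:1+\tau:1:-2]$ 19. $(6,17,24)$: $[1:1-\tau:1:1+\tau]$ 20. $(6,18,23)$: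 $[1:-2:1:1-\tau]$ 21. $(7,16,19)$: $[1:0:-\frac{\tau}{3}:-\frac{3+\tau}{3}]$ 22. $(7,18,20)$: $[1:1+\tau:-\tau:0]$ 23. $(8,16,21)$: $[1:1-\tau:-\tau:0]$ 24. $(8,17,20)$: $[1:0:-\frac{\tau}{3}:\frac{2\tau}{3}]$ 25. $(9,17,19)$: $[1:-2:-\tau:0]$ 26. $(9,18,21)$: $[1:0:-\frac{\tau}{3}:\frac{3-\tau}{3}]$ 27. $(10,13,22)$: $[1:0:\frac{\tau}{3}:\frac{-3+\tau}{3}]$ 28. $(10,15,23)$: $[1:1-\tau:\tau:0]$ 29. $(11,13,24)$: $[1:1+\tau:\tau:0]$ 30. $(11,14,23)$: $[1:0:\frac{\tau}{3}:-\frac{2\tau}{3}]$ 31. $(12,14,22)$: $[1:-2:\tau:0]$ 32. $(12,15,24)$: $[1:0:\frac{\tau}{3}:\frac{3+\tau}{3}]$ Every point is incident with the three listed lines $L_j,L_k,L_l$ and with no fourth line among $L_1,\dots,L_{24}$. The points are pairwise distinct, the remaining pairs of lines (those not occurring together in one of the listed triples) are skew, and every line contains four of the triple points. The divisor $D$ is connected and all crossings are transverse.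
   Context: For $a,b,c,d\in K$ let $L(a,b;c,d)$ be the projective line spanned by $(1,0,a,b)$ and $(0,1,c,d)$, i.e. the image of $[s:t]\mapsto[s:t:as+ct:bs+dt]$. The lines $L_j=L(a,b;c,d)$ are: - $L_1=L(1,0;0,1)$ - $L_2=L(-1,0;0,-1)$ - $L_3=L(-1,0;0,(1-\tau)/2)$ - $L_4=L(-1,0;0,(1+\tau)/2)$ - $L_5=L(1,0;0,-(1+\tau)/2)$ - $L_6=L(1,0;0,(-1+\tau)/2)$ - $L_7=L(-\tau/3,-1-\tau/3;(-3-\tau)/6,(3-\tau)/6)$ - $L_8=L(-\tau/3,2\tau/3;(3-\tau)/6,(3-\tau)/6)$ - $L_9=L(-\tau/3,1-\tau/3;\tau/3,(3-\tau)/6)$ - $L_{10}=L(\tau/3,-1+\tau/3;(-3+\tau)/6,(3+\tau)/6)$ - $L_{11}=L(\tau/3,-2\tau/3;(3+\tau)/6,(3+\tau)/6)$ - $L_{12}=L(\tau/3,1+\tau/3;-\tau/3,(3+\tau)/6)$ - $L_{13}=L(\tau/3,-1+\tau/3;(3+\tau)/6,-\tau/3)$ - $L_{14}=L(\tau/3,-2\tau/3;-\tau/3,-\tau/3)$ - $L_{15}=L(\tau/3,1+\tau/3;(-3+\tau)/6,-\tau/3)$ - $L_{16}=L(-\tau/3,-1-\tau/3;(3-\tau)/6,\tau/3)$ - $L_{17}=L(-\tau/3,2\tau/3;\tau/3,\tau/3)$ - $L_{18}=L(-\tau/3,1-\tau/3;(-3-\tau)/6,\tau/3)$ - $L_{19}=L(-\tau/3,-1-\tau/3;\tau/3,(-3-\tau)/6)$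 - $L_{20}=L(-\tau/3,2\tau/3;(-3-\tau)/6,(-3-\tau)/6)$ - $L_{21}=L(-\tau/3,1-\tau/3;(3-\tau)/6,(-3-\tau)/6)$ - $L_{22}=L(\tau/3,-1+\tau/3;-\tau/3,(-3+\tau)/6)$ - $L_{23}=L(\tau/3,-2\tau/3;(-3+\tau)/6,(-3+\tau)/6)$ - $L_{24}=L(\tau/3,1+\tau/3;(3+\tau)/6,(-3+\tau)/6)$ The singular locus of $D$ is the set of points lying on at least two of the lines. Crossings are transverse at a point if the lines through that point have pairwise distinct tangent directions there. *)

theory Defs
  imports "HOL-Analysis.Analysis" "HOL-Library.Poly_Mapping"
begin

subsection \<open>The field Q(tau)\<close>

definition is_subfield :: "'k::field set \<Rightarrow> bool" where
  "is_subfield S \<longleftrightarrow> 0 \<in> S \<and> 1 \<in> S \<and>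
     (\<forall>x\<in>S. \<forall>y\<in>S. x + y \<in> S \<and> x * y \<in> S) \<and> (\<forall>x\<in>S. - x \<in> S \<and> inverse x \<in> S)"

definition rat_adjoin :: "'k::field_char_0 \<Rightarrow> 'k set" where
  "rat_adjoin x = \<Inter>{S. is_subfield S \<and> \<rat> \<subseteq> S \<and> x \<in> S}"

subsection \<open>Projective three-space\<close>

text \<open>
  A point of projective space is the set of all its homogeneous coordinate vectors, that is, a
  one-dimensional subspace with zero removed. The homogeneous coordinates \<open>x\<^sub>0, x\<^sub>1, x\<^sub>2, x\<^sub>3\<close> are the
  components \<open>x $ 1, x $ 2, x $ 3, x $ 4\<close> of a vector.
\<close>

type_synonym 'k pt = "('k^4) set"

definition proj :: "'k::field^4 \<Rightarrow> 'k pt" where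
  "proj v = {c *s v | c. c \<noteq> 0}"

definition P3 :: "'k::field pt set" where
  "P3 = {proj v | v. v \<noteq> 0}"

definition point :: "'k::field \<Rightarrow> 'k \<Rightarrow> 'k \<Rightarrow> 'k \<Rightarrow> 'k pt" where
  "point a b c d = proj (vector [a, b, c, d])"

definition line :: "'k::field \<Rightarrow> 'k \<Rightarrow> 'k \<Rightarrow> 'k \<Rightarrow> 'k pt set" where
  "line a b c d =
     {point s t (a * s + c * t) (b * s + d * t) | s t. (s, t) \<noteq> (0, 0)}"

definition skew :: "'k::field pt set \<Rightarrow> 'k pt set \<Rightarrow> bool" where
  "skew L M \<longleftrightarrow> L \<inter> M = {}"

definition quartic :: "'k::field pt set" where
  "quartic = {p \<in> P3. \<forall>x\<in>p. (x $ 1)^4 - x $ 1 * (x $ 2)^3 - (x $ 3)^4 + x $ 3 * (x $ 4)^3 = 0}"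

subsection \<open>Forms, Zariski topology and tangent directions\<close>

text \<open>A polynomial in four variables maps exponent vectors to coefficients.\<close>

type_synonym 'k poly4 = "(nat^4) \<Rightarrow>\<^sub>0 'k"

definition homogeneous :: "'k::field poly4 \<Rightarrow> bool" where
  "homogeneous F \<longleftrightarrow> (\<exists>d. \<forall>m\<in>Poly_Mapping.keys F. (\<Sum>i\<in>UNIV. m $ i) = d)"

text \<open>Evaluation in a ring \<open>'r\<close> over the coefficients, along the structure map \<open>h\<close>.\<close>

definition eval_poly4 :: "('k::field \<Rightarrow> 'r::comm_ring_1) \<Rightarrow> 'k poly4 \<Rightarrow> (4 \<Rightarrow> 'r) \<Rightarrow> 'r" where
  "eval_poly4 h F x =
     (\<Sum>m\<in>Poly_Mapping.keys F. h (Poly_Mapping.lookup F m) * (\<Prod>i\<in>UNIV. x i ^ (m $ i)))"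

definition value_at :: "'k::field poly4 \<Rightarrow> 'k^4 \<Rightarrow> 'k" where
  "value_at F u = eval_poly4 (\<lambda>c. c) F (\<lambda>i. u $ i)"

text \<open>The derivative of \<open>F\<close> at \<open>u\<close> along \<open>v\<close>: the coefficient of \<open>X\<close> in \<open>F (u + X v)\<close>.\<close>

definition deriv_at :: "'k::field poly4 \<Rightarrow> 'k^4 \<Rightarrow> 'k^4 \<Rightarrow> 'k" where
  "deriv_at F u v = coeff (eval_poly4 (\<lambda>c. [:c:]) F (\<lambda>i. [:u $ i, v $ i:])) 1"

text \<open>The topology generated by the basic open sets \<open>F \<noteq> 0\<close> for forms \<open>F\<close>.\<close>

definition zariski :: "'k::field pt topology" where
  "zariski = topology_generated_by
     {{p \<in> P3. \<forall>u\<in>p. value_at F u \<noteq> 0} | F. homogeneous F}"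

definition vanishes_on :: "'k::field poly4 \<Rightarrow> 'k pt set \<Rightarrow> bool" where
  "vanishes_on F C \<longleftrightarrow> (\<forall>p\<in>C. \<forall>u\<in>p. value_at F u = 0)"

text \<open>
  The tangent space of projective space at \<open>p\<close>, the class of \<open>u\<close>, is the quotient of \<open>'k^4\<close> by the
  span of \<open>u\<close> (up to the choice of \<open>u\<close>). The Zariski tangent space of \<open>C\<close> at \<open>p\<close> is represented by
  its preimage in \<open>'k^4\<close>. For a line it has dimension two, and it is the tangent direction of the
  line at \<open>p\<close>.
\<close>

definition tangent_space :: "'k::field pt set \<Rightarrow> 'k pt \<Rightarrow> ('k^4) set" where
  "tangent_space C p =
     {v. \<forall>F. homogeneous F \<and> vanishes_on F C \<longrightarrow> (\<forall>u\<in>p. deriv_at F u v = 0)}"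

subsection \<open>Divisors\<close>

text \<open>A divisor is a formal integer combination of curves, each given as a set of points.\<close>

type_synonym 'k divisor = "'k pt set \<Rightarrow>\<^sub>0 int"

definition support :: "'k::field divisor \<Rightarrow> 'k pt set" where
  "support D = \<Union>(Poly_Mapping.keys D)"

definition sing_locus :: "'k::field divisor \<Rightarrow> 'k pt set" where
  "sing_locus D = {p. \<exists>C\<in>Poly_Mapping.keys D. \<exists>C'\<in>Poly_Mapping.keys D. C \<noteq> C' \<and> p \<in> C \<and> p \<in> C'}"

definition connected_divisor :: "'k::field divisor \<Rightarrow> bool" where
  "connected_divisor D \<longleftrightarrow> connectedin zariski (support D)"

definition transverse_at :: "'k::field divisor \<Rightarrow> 'k pt \<Rightarrow> bool" where
  "transverse_at D p \<longleftrightarrow>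
     pairwise (\<lambda>C C'. tangent_space C p \<noteq> tangent_space C' p) {C \<in> Poly_Mapping.keys D. p \<in> C}"

subsection \<open>The 24 lines and the 32 points\<close>

text \<open>The lines are numbered from 1, so line \<open>j\<close> is entry \<open>j - 1\<close> of the list.\<close>

definition L :: "'k::field_char_0 \<Rightarrow> nat \<Rightarrow> 'k pt set" where
  "L \<tau> j =
    [line 1 0 0 1,
     line (-1) 0 0 (-1),
     line (-1) 0 0 ((1 - \<tau>) / 2),
     line (-1) 0 0 ((1 + \<tau>) / 2),
     line 1 0 0 (-(1 + \<tau>) / 2),
     line 1 0 0 ((-1 + \<tau>) / 2),
     line (-\<tau> / 3) (-1 - \<tau> / 3) ((-3 - \<tau>) / 6) ((3 - \<tau>) / 6),
     line (-\<tau> / 3) (2 * \<tau> / 3) ((3 - \<tau>) / 6) ((3 - \<tau>) / 6),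
     line (-\<tau> / 3) (1 - \<tau> / 3) (\<tau> / 3) ((3 - \<tau>) / 6),
     line (\<tau> / 3) (-1 + \<tau> / 3) ((-3 + \<tau>) / 6) ((3 + \<tau>) / 6),
     line (\<tau> / 3) (-2 * \<tau> / 3) ((3 + \<tau>) / 6) ((3 + \<tau>) / 6),
     line (\<tau> / 3) (1 + \<tau> / 3) (-\<tau> / 3) ((3 + \<tau>) / 6),
     line (\<tau> / 3) (-1 + \<tau> / 3) ((3 + \<tau>) / 6) (-\<tau> / 3),
     line (\<tau> / 3) (-2 * \<tau> / 3) (-\<tau> / 3) (-\<tau> / 3),
     line (\<tau> / 3) (1 + \<tau> / 3) ((-3 + \<tau>) / 6) (-\<tau> / 3),
     line (-\<tau> / 3) (-1 - \<tau> / 3) ((3 - \<tau>) / 6) (\<tau> / 3),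
     line (-\<tau> / 3) (2 * \<tau> / 3) (\<tau> / 3) (\<tau> / 3),
     line (-\<tau> / 3) (1 - \<tau> / 3) ((-3 - \<tau>) / 6) (\<tau> / 3),
     line (-\<tau> / 3) (-1 - \<tau> / 3) (\<tau> / 3) ((-3 - \<tau>) / 6),
     line (-\<tau> / 3) (2 * \<tau> / 3) ((-3 - \<tau>) / 6) ((-3 - \<tau>) / 6),
     line (-\<tau> / 3) (1 - \<tau> / 3) ((3 - \<tau>) / 6) ((-3 - \<tau>) / 6),
     line (\<tau> / 3) (-1 + \<tau> / 3) (-\<tau> / 3) ((-3 + \<tau>) / 6),
     line (\<tau> / 3) (-2 * \<tau> / 3) ((-3 + \<tau>) / 6) ((-3 + \<tau>) / 6),
     line (\<tau> / 3) (1 + \<tau> / 3) ((3 + \<tau>) / 6) ((-3 + \<tau>) / 6)] ! (j - 1)"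

definition D :: "'k::field_char_0 \<Rightarrow> 'k divisor" where
  "D \<tau> = (\<Sum>j=1..24. Poly_Mapping.single (L \<tau> j) 1)"

definition triple_points :: "'k::field_char_0 \<Rightarrow> ((nat \<times> nat \<times> nat) \<times> 'k pt) list" where
  "triple_points \<tau> =
    [((1, 5, 6), point 1 0 1 0),
     ((1, 7, 10), point 1 (-2) 1 (-2)),
     ((1, 8, 12), point 1 (1 + \<tau>) 1 (1 + \<tau>)),
     ((1, 9, 11), point 1 (1 - \<tau>) 1 (1 - \<tau>)),
     ((2, 3, 4), point 1 0 (-1) 0),
     ((2, 19, 23), point 1 (1 + \<tau>) (-1) (-1 - \<tau>)),
     ((2, 20, 22), point 1 (1 - \<tau>) (-1) (-1 + \<tau>)),
     ((2, 21, 24), point 1 (-2) (-1) 2),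
     ((3, 7, 14), point 1 (1 - \<tau>) (-1) (-1 - \<tau>)),
     ((3, 8, 13), point 1 (-2) (-1) (-1 + \<tau>)),
     ((3, 9, 15), point 1 (1 + \<tau>) (-1) 2),
     ((4, 10, 17), point 1 (1 + \<tau>) (-1) (-1 + \<tau>)),
     ((4, 11, 16), point 1 (-2) (-1) (-1 - \<tau>)),
     ((4, 12, 18), point 1 (1 - \<tau>) (-1) 2),
     ((5, 13, 19), point 1 (1 - \<tau>) 1 (-2)),
     ((5, 14, 21), point 1 (1 + \<tau>) 1 (1 - \<tau>)),
     ((5, 15, 20), point 1 (-2) 1 (1 + \<tau>)),
     ((6, 16, 22), point 1 (1 + \<tau>) 1 (-2)),
     ((6, 17, 24), point 1 (1 - \<tau>) 1 (1 + \<tau>)),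
     ((6, 18, 23), point 1 (-2) 1 (1 - \<tau>)),
     ((7, 16, 19), point 1 0 (-\<tau> / 3) (-(3 + \<tau>) / 3)),
     ((7, 18, 20), point 1 (1 + \<tau>) (-\<tau>) 0),
     ((8, 16, 21), point 1 (1 - \<tau>) (-\<tau>) 0),
     ((8, 17, 20), point 1 0 (-\<tau> / 3) (2 * \<tau> / 3)),
     ((9, 17, 19), point 1 (-2) (-\<tau>) 0),
     ((9, 18, 21), point 1 0 (-\<tau> / 3) ((3 - \<tau>) / 3)),
     ((10, 13, 22), point 1 0 (\<tau> / 3) ((-3 + \<tau>) / 3)),
     ((10, 15, 23), point 1 (1 - \<tau>) \<tau> 0),
     ((11, 13, 24), point 1 (1 + \<tau>) \<tau> 0),
     ((11, 14, 23), point 1 0 (\<tau> / 3) (-2 * \<tau> / 3)),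
     ((12, 14, 22), point 1 (-2) \<tau> 0),
     ((12, 15, 24), point 1 0 (\<tau> / 3) ((3 + \<tau>) / 3))]"

end

theory Submission
  imports Defs
begin

text \<open>
  Put \<open>f s t = s^4 - s * t^3\<close>. The quartic is the surface \<open>f x\<^sub>0 x\<^sub>1 = f x\<^sub>2 x\<^sub>3\<close>, and
  \<open>line a b c d\<close> is the graph of the matrix \<open>M\<close> with rows \<open>(a, c)\<close> and \<open>(b, d)\<close>, the set of
  all \<open>[v : M v]\<close>. It lies on the quartic if and only if \<open>f\<close> is invariant under \<open>M\<close>. The 24
  matrices of the statement form the complex reflection group \<open>G\<^sub>4\<close>, of order 24, whose
  invariant of degree four is \<open>f\<close>.

  Two lines with matrices \<open>M\<close> and \<open>N\<close> meet where \<open>M v = N v\<close>, that is, only if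
  \<open>det (M - N) = 0\<close>, and for \<open>M \<noteq> N\<close> in at most one point (\<open>skewI\<close>, \<open>distinct_lines_meet_once\<close>).
  Equivalently \<open>M\<^sup>-\<^sup>1 N\<close> is a reflection with fixed vector \<open>v\<close>. The group has eight reflections,
  all of order three, and they come in four pairs of mutually inverse ones, each pair with one
  common fixed direction. So every line has four points on other lines, there are two other lines
  through each of them, and there are \<open>24 * 4 / 3 = 32\<close> such points, one for each coset of the
  four subgroups generated by a reflection. As reflections generate the group, any two lines are
  joined by a chain of lines that meet.

  This explains the numbers. The listed labels and coordinates are verified one by one:
  the coordinates are written as pairs of integers, using that \<open>1\<close> and \<open>\<tau>\<close> are independent over the rationals
  (\<open>qval_inject\<close>), and the incidences and the determinants for all pairs of lines are evaluated
  (\<open>check_incidence\<close>, \<open>check_det\<close>). A point on two lines with vanishing determinant is then the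
  listed point on both of them, because the lines do not meet twice.

  Two assertions are not finite checks. Transversality holds because the tangent space of a line is
  the plane of vectors over the line (\<open>tangent_space_line\<close>), so that distinct lines have distinct
  tangent spaces. Connectedness follows from the chains once a single line is known to be
  connected, and a line is even irreducible: every open set that meets it contains all but
  finitely many of its points (\<open>open_cofinite_on_line\<close>).
\<close>

section \<open>Lines as graphs of matrices\<close>

lemma vector_4:
  "(vector [a, b, c, d] :: 'a::zero^4) $ 1 = a"
  "(vector [a, b, c, d] :: 'a::zero^4) $ 2 = b"
  "(vector [a, b, c, d] :: 'a::zero^4) $ 3 = c"
  "(vector [a, b, c, d] :: 'a::zero^4) $ 4 = d"
  unfolding vector_def by simp_all

lemma vec4_eq_iff: "(u :: 'a^4) = v \<longleftrightarrow> u $ 1 = v $ 1 \<and> u $ 2 = v $ 2 \<and> u $ 3 = v $ 3 \<and> u $ 4 = v $ 4"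
  by (simp add: vec_eq_iff forall_4)

lemma proj_refl: "v \<in> proj v"
  unfolding proj_def by (auto intro!: exI[of _ 1])

lemma proj_scale:
  fixes v :: "'k::field^4"
  assumes "c \<noteq> 0"
  shows "proj (c *s v) = proj v"
proof -
  have sub: "proj (c *s v) \<subseteq> proj v" if "c \<noteq> 0" for c and v :: "'k^4"
    using that unfolding proj_def by (auto simp: vector_smult_assoc)
  have "v = (1 / c) *s (c *s v)" using assms by (simp add: vector_smult_assoc)
  then have "proj v \<subseteq> proj (c *s v)" using sub[of "1 / c" "c *s v"] assms by simp
  with sub[OF assms] show ?thesis by blast
qed

lemma proj_eqD: "proj u = proj v \<Longrightarrow> \<exists>c. c \<noteq> 0 \<and> u = c *s v"
  using proj_refl[of u] unfolding proj_def[of v] by auto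

text \<open>
  The affine cone over \<open>line a b c d\<close>, with the origin included so that it is a plane.
\<close>

definition line_cone :: "'k::field \<Rightarrow> 'k \<Rightarrow> 'k \<Rightarrow> 'k \<Rightarrow> ('k^4) set" where
  "line_cone a b c d = {v. v $ 3 = a * v $ 1 + c * v $ 2 \<and> v $ 4 = b * v $ 1 + d * v $ 2}"

lemma line_cone_add: "u \<in> line_cone a b c d \<Longrightarrow> v \<in> line_cone a b c d \<Longrightarrow> u + v \<in> line_cone a b c d"
  by (auto simp: line_cone_def algebra_simps)

lemma line_cone_scale: "u \<in> line_cone a b c d \<Longrightarrow> x *s u \<in> line_cone a b c d"
  by (auto simp: line_cone_def algebra_simps)

lemma line_cone_eqI:
  "u \<in> line_cone a b c d \<Longrightarrow> v \<in> line_cone a b c d \<Longrightarrow> u $ 1 = v $ 1 \<Longrightarrow> u $ 2 = v $ 2 \<Longrightarrow> u = v"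
  by (auto simp: line_cone_def vec4_eq_iff)

lemma line_cone_nonzero: "u \<in> line_cone a b c d \<Longrightarrow> u \<noteq> 0 \<Longrightarrow> u $ 1 \<noteq> 0 \<or> u $ 2 \<noteq> 0"
  using line_cone_eqI[of u a b c d 0] by (auto simp: line_cone_def)

lemma line_eq: "line a b c d = proj ` (line_cone a b c d - {0})"
proof (intro set_eqI iffI)
  fix p assume "p \<in> line a b c d"
  then obtain s t where st: "(s, t) \<noteq> (0, 0)" and
      p: "p = proj (vector [s, t, a * s + c * t, b * s + d * t])"
    unfolding line_def point_def by auto
  show "p \<in> proj ` (line_cone a b c d - {0})"
    unfolding p using st by (intro imageI) (auto simp: line_cone_def vector_4 vec4_eq_iff)
next
  fix p assume "p \<in> proj ` (line_cone a b c d - {0})"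
  then obtain v where v: "p = proj v" "v \<in> line_cone a b c d" "v \<noteq> 0" by auto
  have "v = vector [v $ 1, v $ 2, a * v $ 1 + c * v $ 2, b * v $ 1 + d * v $ 2]"
    using v(2) by (simp add: vec4_eq_iff vector_4 line_cone_def)
  with v(1) have "p = point (v $ 1) (v $ 2) (a * v $ 1 + c * v $ 2) (b * v $ 1 + d * v $ 2)"
    unfolding point_def by metis
  then show "p \<in> line a b c d"
    using line_cone_nonzero[OF v(2,3)] unfolding line_def by fastforce
qed

lemma line_memE:
  assumes "p \<in> line a b c d" "u \<in> p"
  shows "u \<in> line_cone a b c d" "u \<noteq> 0" "p = proj u"
proof -
  obtain v where v: "v \<in> line_cone a b c d" "v \<noteq> 0" "p = proj v"
    using assms(1) by (auto simp: line_eq)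
  then obtain e where e: "e \<noteq> 0" "u = e *s v" using assms(2) unfolding proj_def by auto
  show "u \<in> line_cone a b c d" using e v line_cone_scale by metis
  show "u \<noteq> 0" using e v by simp
  show "p = proj u" using e v proj_scale by metis
qed

lemma proj_in_line: "proj v \<in> line a b c d \<longleftrightarrow> v \<in> line_cone a b c d \<and> v \<noteq> 0"
proof
  assume "proj v \<in> line a b c d"
  from line_memE[OF this proj_refl] show "v \<in> line_cone a b c d \<and> v \<noteq> 0" by simp
qed (simp add: line_eq)

lemma point_in_line:
  "point 1 x y z \<in> line a b c d \<longleftrightarrow> y = a + c * x \<and> z = b + d * x"
  unfolding point_def proj_in_line by (auto simp: line_cone_def vector_4 vec4_eq_iff)

lemma point_eq_iff: "point 1 x y z = point 1 x' y' z' \<longleftrightarrow> x = x' \<and> y = y' \<and> z = z'"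
  unfolding point_def by (auto dest!: proj_eqD simp: vec4_eq_iff vector_4)

lemma line_inject: "line a b c d = line a' b' c' d' \<longleftrightarrow> a = a' \<and> b = b' \<and> c = c' \<and> d = d'"
proof
  assume eq: "line a b c d = line a' b' c' d'"
  have "point 1 0 a b \<in> line a b c d" "point 1 1 (a + c) (b + d) \<in> line a b c d"
    by (simp_all add: point_in_line)
  then show "a = a' \<and> b = b' \<and> c = c' \<and> d = d'"
    unfolding eq by (auto simp: point_in_line)
qed simp

text \<open>
  For a common point \<open>[v : M v] = [v : M' v]\<close> the vector \<open>v\<close> is in the kernel of \<open>M - M'\<close>, and
  Cramer's rule makes it zero when the determinant of \<open>M - M'\<close> is nonzero.
\<close>

lemma skewI:
  fixes a b c d :: "'k::field"
  assumes "(a - a') * (d - d') \<noteq> (b - b') * (c - c')"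
  shows "skew (line a b c d) (line a' b' c' d')"
proof -
  have False if "p \<in> line a b c d" "p \<in> line a' b' c' d'" for p
  proof -
    obtain u where u: "u \<in> line_cone a b c d" "u \<noteq> 0" "p = proj u"
      using \<open>p \<in> line a b c d\<close> by (auto simp: line_eq)
    have u': "u \<in> line_cone a' b' c' d'" using that(2) u(3) by (simp add: proj_in_line)
    have eqs: "(a - a') * u $ 1 + (c - c') * u $ 2 = 0" "(b - b') * u $ 1 + (d - d') * u $ 2 = 0"
      using u(1) u' by (simp_all add: line_cone_def algebra_simps)
    let ?det = "(a - a') * (d - d') - (b - b') * (c - c')"
    have "?det * u $ 1 = (d - d') * ((a - a') * u $ 1 + (c - c') * u $ 2)
        - (c - c') * ((b - b') * u $ 1 + (d - d') * u $ 2)"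
      and "?det * u $ 2 = (a - a') * ((b - b') * u $ 1 + (d - d') * u $ 2)
        - (b - b') * ((a - a') * u $ 1 + (c - c') * u $ 2)"
      by (simp_all add: algebra_simps)
    then have "?det * u $ 1 = 0" "?det * u $ 2 = 0" by (simp_all add: eqs)
    then show False using assms line_cone_nonzero[OF u(1,2)] by auto
  qed
  then show ?thesis by (auto simp: skew_def)
qed

text \<open>
  The first halves of two common points lie in the kernel of a nonzero two by two matrix, which has
  dimension at most one. Hence they are proportional, and so are the points.
\<close>

lemma distinct_lines_meet_once:
  fixes a b c d :: "'k::field"
  assumes neq: "line a b c d \<noteq> line a' b' c' d'"
    and p: "p \<in> line a b c d" "p \<in> line a' b' c' d'"
    and q: "q \<in> line a b c d" "q \<in> line a' b' c' d'"
  shows "p = q"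
proof -
  obtain u where u: "u \<in> line_cone a b c d" "u \<noteq> 0" "p = proj u" using p(1) by (auto simp: line_eq)
  obtain v where v: "v \<in> line_cone a b c d" "v \<noteq> 0" "q = proj v" using q(1) by (auto simp: line_eq)
  have u': "u \<in> line_cone a' b' c' d'" and v': "v \<in> line_cone a' b' c' d'"
    using p q u v by (simp_all add: proj_in_line)
  have eqs: "(a - a') * u $ 1 + (c - c') * u $ 2 = 0" "(b - b') * u $ 1 + (d - d') * u $ 2 = 0"
      "(a - a') * v $ 1 + (c - c') * v $ 2 = 0" "(b - b') * v $ 1 + (d - d') * v $ 2 = 0"
    using u(1) u' v(1) v' by (simp_all add: line_cone_def algebra_simps)
  \<comment> \<open>The two vectors are proportional because \<open>?w\<close> annihilates every row \<open>(x, y)\<close> of \<open>M - M'\<close>.\<close>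
  let ?w = "u $ 1 * v $ 2 - u $ 2 * v $ 1"
  have wedge: "?w * x = 0" "?w * y = 0"
    if "x * u $ 1 + y * u $ 2 = 0" "x * v $ 1 + y * v $ 2 = 0" for x y
  proof -
    have "?w * x = v $ 2 * (x * u $ 1 + y * u $ 2) - u $ 2 * (x * v $ 1 + y * v $ 2)"
      "?w * y = u $ 1 * (x * v $ 1 + y * v $ 2) - v $ 1 * (x * u $ 1 + y * u $ 2)"
      by (simp_all add: algebra_simps)
    then show "?w * x = 0" "?w * y = 0" by (simp_all add: that)
  qed
  have "?w = 0"
    using wedge[OF eqs(1,3)] wedge[OF eqs(2,4)] neq unfolding line_inject by auto
  obtain e where e: "u $ 1 = e * v $ 1" "u $ 2 = e * v $ 2"
  proof (cases "v $ 1 = 0")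
    case True
    then have "v $ 2 \<noteq> 0" using line_cone_nonzero[OF v(1,2)] by simp
    with True \<open>?w = 0\<close> show ?thesis by (intro that[of "u $ 2 / v $ 2"]) auto
  next
    case False
    with \<open>?w = 0\<close> show ?thesis by (intro that[of "u $ 1 / v $ 1"]) (auto simp: field_simps)
  qed
  have "u = e *s v"
    by (rule line_cone_eqI[OF u(1) line_cone_scale[OF v(1)]]) (simp_all add: e)
  then show "p = q" using u v proj_scale[of e v] by (cases "e = 0") auto
qed

lemma line_subset_P3: "line a b c d \<subseteq> P3"
  by (auto simp: line_eq P3_def)

text \<open>
  The five equations compare the coefficients of \<open>s^4, s^3 t, s^2 t^2, s t^3, t^4\<close> in
  \<open>f (a s + c t) (b s + d t) = f s t\<close>, where \<open>f s t = s^4 - s t^3\<close>.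
\<close>

lemma line_in_quartic:
  assumes "a^4 - a * b^3 = 1" "4 * a^3 * c - 3 * a * b^2 * d - c * b^3 = 0"
    "6 * a^2 * c^2 - 3 * a * b * d^2 - 3 * c * b^2 * d = 0"
    "4 * a * c^3 - a * d^3 - 3 * c * b * d^2 = -1" "c^4 - c * d^3 = 0"
  shows "line a b c d \<subseteq> quartic"
proof -
  have "u $ 1 ^ 4 - u $ 1 * u $ 2 ^ 3 - u $ 3 ^ 4 + u $ 3 * u $ 4 ^ 3 = 0"
    if u: "u \<in> line_cone a b c d" for u
  proof -
    define s t where "s = u $ 1" and "t = u $ 2"
    have "(a * s + c * t)^4 - (a * s + c * t) * (b * s + d * t)^3
      = (a^4 - a * b^3) * s^4 + (4 * a^3 * c - 3 * a * b^2 * d - c * b^3) * s^3 * t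
      + (6 * a^2 * c^2 - 3 * a * b * d^2 - 3 * c * b^2 * d) * s^2 * t^2
      + (4 * a * c^3 - a * d^3 - 3 * c * b * d^2) * s * t^3 + (c^4 - c * d^3) * t^4"
      by algebra
    then have "(a * s + c * t)^4 - (a * s + c * t) * (b * s + d * t)^3 = s^4 - s * t^3"
      unfolding assms by simp
    then show ?thesis using u by (simp add: line_cone_def s_def t_def algebra_simps)
  qed
  then show ?thesis
    using line_memE(1) line_subset_P3 unfolding quartic_def by blast
qed

section \<open>Forms and tangent spaces\<close>

text \<open>
  Both the derivative of a form along a vector and its values along a line are read off from this
  polynomial in one variable.
\<close>

lemma poly_eval_poly4:
  "poly (eval_poly4 (\<lambda>c. [:c:]) F (\<lambda>i. [:u $ i, v $ i:])) x = value_at F (u + x *s v)"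
  by (simp add: eval_poly4_def value_at_def poly_sum poly_mult poly_prod poly_power)

lemma value_at_scale:
  assumes "homogeneous F"
  obtains n where "\<And>x v. value_at F (x *s v) = x ^ n * value_at F v"
proof -
  obtain n where n: "\<And>m. m \<in> Poly_Mapping.keys F \<Longrightarrow> (\<Sum>i\<in>UNIV. m $ i) = n"
    using assms unfolding homogeneous_def by blast
  have "(\<Prod>i\<in>UNIV. (x * v $ i) ^ (m $ i)) = x ^ n * (\<Prod>i\<in>UNIV. v $ i ^ (m $ i))"
    if "m \<in> Poly_Mapping.keys F" for m x v
    by (simp add: power_mult_distrib prod.distrib power_sum[symmetric] n[OF that])
  then have "value_at F (x *s v) = x ^ n * value_at F v" for x v
    unfolding value_at_def eval_poly4_def sum_distrib_left
    by (intro sum.cong) (auto simp: mult_ac)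
  then show ?thesis by (rule that)
qed

text \<open>
  Homogeneity makes vanishing of a form a property of the point and not of the coordinate vector.
\<close>

lemma value_at_proj:
  assumes "homogeneous F" "u \<in> p" "u' \<in> p" "p \<in> line a b c d" "value_at F u = 0"
  shows "value_at F u' = 0"
proof -
  have "u' \<in> proj u" using line_memE[OF assms(4,2)] assms(3) by simp
  then obtain e where "u' = e *s u" unfolding proj_def by auto
  then show ?thesis using value_at_scale[OF assms(1)] assms(5) by (metis mult_zero_right)
qed

definition linear_form :: "'k::field^4 \<Rightarrow> 'k poly4" where
  "linear_form c = (\<Sum>i\<in>UNIV. Poly_Mapping.single (axis i 1) (c $ i))"

lemma lookup_linear_form: "Poly_Mapping.lookup (linear_form c) (axis i 1) = c $ i"
  by (simp add: linear_form_def lookup_sum lookup_single when_def axis_eq_axis)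

lemma keys_linear_form: "Poly_Mapping.keys (linear_form c) \<subseteq> range (\<lambda>i. axis i 1)"
  unfolding linear_form_def by (rule order_trans[OF keys_sum]) auto

lemma homogeneous_linear_form: "homogeneous (linear_form c)"
proof -
  have "(\<Sum>j\<in>UNIV. (axis i 1 :: nat^4) $ j) = 1" for i by (simp add: axis_def)
  then show ?thesis unfolding homogeneous_def using keys_linear_form[of c] by blast
qed

lemma eval_linear_form:
  assumes "h 0 = 0"
  shows "eval_poly4 h (linear_form c) x = (\<Sum>i\<in>UNIV. h (c $ i) * x i)"
proof -
  have "(\<Prod>j\<in>UNIV. x j ^ ((axis i 1 :: nat^4) $ j)) = x i" for i
  proof -
    have "(\<Prod>j\<in>UNIV. x j ^ ((axis i 1 :: nat^4) $ j)) = (\<Prod>j\<in>UNIV. if j = i then x j else 1)"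
      by (intro prod.cong) (auto simp: axis_def)
    then show ?thesis by simp
  qed
  moreover have "eval_poly4 h (linear_form c) x = (\<Sum>m\<in>range (\<lambda>i. axis i 1).
      h (Poly_Mapping.lookup (linear_form c) m) * (\<Prod>j\<in>UNIV. x j ^ (m $ j)))"
    unfolding eval_poly4_def
    by (intro sum.mono_neutral_left) (use keys_linear_form in \<open>auto simp: in_keys_iff assms\<close>)
  moreover have "inj (\<lambda>i::4. axis i (1::nat))" by (auto simp: inj_def axis_eq_axis)
  ultimately show ?thesis by (simp add: sum.reindex lookup_linear_form del: One_nat_def)
qed

lemma value_at_linear_form: "value_at (linear_form c) u = (\<Sum>i\<in>UNIV. c $ i * u $ i)"
  by (simp add: value_at_def eval_linear_form)

lemma deriv_at_linear_form: "deriv_at (linear_form c) u v = (\<Sum>i\<in>UNIV. c $ i * v $ i)"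
  by (simp add: deriv_at_def eval_linear_form coeff_sum mult.commute)

text \<open>
  The two linear equations of the line bound the tangent space from above. Conversely, let a form
  vanish on the line and let \<open>u\<close> and \<open>v\<close> lie over the line. Then \<open>X \<mapsto> F (u + X v)\<close> has
  infinitely many roots, so it is the zero polynomial, and its linear coefficient vanishes.
\<close>

lemma tangent_space_line:
  fixes a b c d :: "'k::field_char_0"
  assumes p: "p \<in> line a b c d"
  shows "tangent_space (line a b c d) p = line_cone a b c d"
proof (intro set_eqI iffI)
  fix v assume v: "v \<in> tangent_space (line a b c d) p"
  obtain u where u: "u \<in> p" using p by (auto simp: line_eq intro: proj_refl)
  have "(\<Sum>i\<in>UNIV. e $ i * v $ i) = 0"
    if "\<And>w. w \<in> line_cone a b c d \<Longrightarrow> (\<Sum>i\<in>UNIV. e $ i * w $ i) = 0" for e :: "'k^4"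
  proof -
    have "vanishes_on (linear_form e) (line a b c d)"
      using that line_memE(1) unfolding vanishes_on_def value_at_linear_form by blast
    then have "deriv_at (linear_form e) u v = 0"
      using v u homogeneous_linear_form unfolding tangent_space_def by blast
    then show ?thesis by (simp add: deriv_at_linear_form)
  qed
  \<comment> \<open>the coefficient vectors of the two equations that define the line\<close>
  from this[of "vector [a, c, -1, 0]"] this[of "vector [b, d, 0, -1]"]
  show "v \<in> line_cone a b c d" by (simp add: sum_4 vector_4 line_cone_def)
next
  fix v assume v: "v \<in> line_cone a b c d"
  have "deriv_at F u v = 0" if F: "vanishes_on F (line a b c d)" and u: "u \<in> p" for F u
  proof -
    let ?g = "eval_poly4 (\<lambda>c. [:c:]) F (\<lambda>i. [:u $ i, v $ i:])"
    note u' = line_memE[OF p u]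
    have root: "poly ?g x = 0" if "u + x *s v \<noteq> 0" for x
    proof -
      have "proj (u + x *s v) \<in> line a b c d"
        using that line_cone_add[OF u'(1) line_cone_scale[OF v]] by (simp add: proj_in_line)
      then show ?thesis
        using F proj_refl unfolding poly_eval_poly4 vanishes_on_def by blast
    qed
    \<comment> \<open>\<open>u + x v\<close> may be zero, and then it is not a point of the line, but for one \<open>x\<close> at most\<close>
    have "finite {x. u + x *s v = 0}"
    proof -
      have "x = y" if "u + x *s v = 0" "u + y *s v = 0" for x y
      proof -
        have "v \<noteq> 0" using that(1) u'(2) by auto
        moreover have "(x - y) *s v = (u + x *s v) - (u + y *s v)"
          by (simp add: vec.scale_left_diff_distrib)
        ultimately show ?thesis by (simp add: that)
      qed
      then have "{x. u + x *s v = 0} \<subseteq> {y}" if "u + y *s v = 0" for y using that by blast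
      then show ?thesis by (cases "\<exists>y. u + y *s v = 0") (auto intro: finite_subset)
    qed
    then have "infinite (UNIV - {x. u + x *s v = 0})"
      using infinite_UNIV_char_0 by (simp add: Diff_infinite_finite)
    then have "infinite {x. poly ?g x = 0}"
      by (rule infinite_super[rotated]) (use root in blast)
    then have "?g = 0" using poly_roots_finite by blast
    then show ?thesis by (simp add: deriv_at_def)
  qed
  then show "v \<in> tangent_space (line a b c d) p" unfolding tangent_space_def by blast
qed

section \<open>Irreducibility of lines and connectedness\<close>

lemma topspace_zariski: "P3 \<subseteq> topspace zariski"
proof
  fix p :: "'k::field pt" assume p: "p \<in> P3"
  \<comment> \<open>All of projective space is the basic open set of the constant form 1.\<close>
  have "homogeneous (Poly_Mapping.single 0 1 :: 'k poly4)" by (auto simp: homogeneous_def)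
  moreover have "value_at (Poly_Mapping.single 0 1 :: 'k poly4) u = 1" for u
    by (simp add: value_at_def eval_poly4_def)
  ultimately have "P3 \<in> {{p \<in> P3. \<forall>u\<in>p. value_at F u \<noteq> 0} | F :: 'k poly4. homogeneous F}"
    by (intro CollectI exI[of _ "Poly_Mapping.single 0 1"]) simp
  then show "p \<in> topspace zariski"
    using p unfolding zariski_def topology_generated_by_topspace by (rule UnionI)
qed

lemma infinite_line: "infinite (line a b c (d :: 'k::field_char_0))"
proof -
  have "inj (\<lambda>x. point 1 x (a + c * x) (b + d * x))" by (auto simp: inj_def point_eq_iff)
  then have "infinite (range (\<lambda>x. point 1 x (a + c * x) (b + d * x)))"
    using infinite_UNIV_char_0 finite_imageD by blast
  then show ?thesis by (rule infinite_super[rotated]) (auto simp: point_in_line)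
qed

text \<open>
  Complete \<open>u\<close> to a basis \<open>u, v\<close> of the plane over the line. Besides the class of \<open>v\<close>, the points
  of the line are the classes of \<open>u + x v\<close>, and at these the form is a polynomial in \<open>x\<close>, which
  is not zero because its value at \<open>x = 0\<close> is not.
\<close>

lemma finite_zeros_on_line:
  fixes a b c d :: "'k::field_char_0"
  assumes F: "homogeneous F" and p: "p \<in> line a b c d" and u: "u \<in> p" "value_at F u \<noteq> 0"
  shows "finite {q \<in> line a b c d. \<exists>w\<in>q. value_at F w = 0}"
proof -
  note u' = line_memE[OF p u(1)]
  obtain v where v: "v \<in> line_cone a b c d" and det: "u $ 1 * v $ 2 - u $ 2 * v $ 1 \<noteq> 0"
  proof (cases "u $ 1 = 0")
    case True
    then have "u $ 2 \<noteq> 0" using line_cone_nonzero[OF u'(1,2)] by simp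
    with True show ?thesis by (intro that[of "vector [1, 0, a, b]"]) (auto simp: line_cone_def vector_4)
  next
    case False
    then show ?thesis by (intro that[of "vector [0, 1, c, d]"]) (auto simp: line_cone_def vector_4)
  qed
  let ?g = "eval_poly4 (\<lambda>c. [:c:]) F (\<lambda>i. [:u $ i, v $ i:])"
  have "poly ?g 0 \<noteq> 0" using u(2) unfolding poly_eval_poly4 by simp
  then have fin: "finite {x. poly ?g x = 0}" by (intro poly_roots_finite) auto
  have "q \<in> insert (proj v) ((\<lambda>x. proj (u + x *s v)) ` {x. poly ?g x = 0})"
    if q: "q \<in> line a b c d" and w: "w \<in> q" "value_at F w = 0" for q w
  proof -
    note w' = line_memE[OF q w(1)]
    let ?D = "u $ 1 * v $ 2 - u $ 2 * v $ 1"
    let ?x = "(w $ 1 * v $ 2 - w $ 2 * v $ 1) / ?D" and ?y = "(u $ 1 * w $ 2 - u $ 2 * w $ 1) / ?D"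
    \<comment> \<open>Cramer's rule in the basis \<open>u, v\<close>\<close>
    have wuv: "w = ?x *s u + ?y *s v"
      by (rule line_cone_eqI[OF w'(1) line_cone_add[OF line_cone_scale[OF u'(1)] line_cone_scale[OF v]]])
        (use det in \<open>simp_all add: divide_simps, simp_all add: algebra_simps\<close>)
    show ?thesis
    proof (cases "?x = 0")
      case True
      then have eq: "w = ?y *s v" using wuv by (metis add_0 vec.scale_zero_left)
      then have "?y \<noteq> 0" using w'(2) by (metis vec.scale_zero_left)
      then have "q = proj v" using eq w'(3) proj_scale by metis
      then show ?thesis by simp
    next
      case False
      define z where "z = ?y / ?x"
      have eq: "w = ?x *s (u + z *s v)"
        by (subst wuv, use False in \<open>simp add: z_def vec.scale_right_distrib vector_smult_assoc\<close>)
      have qz: "q = proj (u + z *s v)" using eq w'(3) proj_scale[OF False] by metis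
      then have "value_at F (u + z *s v) = 0"
        using value_at_proj[OF F w(1) _ q w(2)] proj_refl by blast
      then show ?thesis using qz by (simp add: poly_eval_poly4)
    qed
  qed
  then have "{q \<in> line a b c d. \<exists>w\<in>q. value_at F w = 0}
      \<subseteq> insert (proj v) ((\<lambda>x. proj (u + x *s v)) ` {x. poly ?g x = 0})" by blast
  then show ?thesis using fin by (auto intro: finite_subset)
qed

text \<open>
  The basic open sets have the property by \<open>finite_zeros_on_line\<close>, and it passes to finite
  intersections and arbitrary unions: if an intersection meets the line, so do both of its members,
  and each of them omits only finitely many points.
\<close>

lemma open_cofinite_on_line:
  fixes a b c d :: "'k::field_char_0"
  assumes "openin zariski U" "U \<inter> line a b c d \<noteq> {}"
  shows "finite (line a b c d - U)"
proof -
  have "generate_topology_on {{p \<in> P3. \<forall>u\<in>p. value_at F u \<noteq> 0} | F. homogeneous F} U"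
    using assms(1) unfolding zariski_def openin_topology_generated_by_iff .
  then show ?thesis using assms(2)
  proof (induction rule: generate_topology_on.induct)
    case (Int U V)
    then have "finite ((line a b c d - U) \<union> (line a b c d - V))" by blast
    then show ?case by (rule finite_subset[rotated]) blast
  next
    case (UN K)
    then obtain U where "U \<in> K" "U \<inter> line a b c d \<noteq> {}" by blast
    with UN.IH have "finite (line a b c d - U)" by blast
    then show ?case by (rule finite_subset[rotated]) (use \<open>U \<in> K\<close> in blast)
  next
    case (Basis U)
    then obtain F p where F: "homogeneous F" "U = {p \<in> P3. \<forall>u\<in>p. value_at F u \<noteq> 0}"
        and p: "p \<in> line a b c d" "p \<in> U" by blast
    obtain u where "u \<in> p" using p(1) by (auto simp: line_eq intro: proj_refl)
    then have "finite {q \<in> line a b c d. \<exists>w\<in>q. value_at F w = 0}"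
      using F p by (intro finite_zeros_on_line) auto
    then show ?case by (rule finite_subset[rotated]) (use F line_subset_P3 in blast)
  qed simp
qed

lemma connectedin_line: "connectedin zariski (line a b c (d :: 'k::field_char_0))"
  unfolding connectedin
proof (intro conjI notI; (elim exE conjE)?)
  show "line a b c d \<subseteq> topspace zariski" using line_subset_P3 topspace_zariski by blast
next
  fix U V :: "'k pt set"
  assume UV: "openin zariski U" "openin zariski V" "line a b c d \<subseteq> U \<union> V"
    "U \<inter> V \<inter> line a b c d = {}" "U \<inter> line a b c d \<noteq> {}" "V \<inter> line a b c d \<noteq> {}"
  then have "finite ((line a b c d - U) \<union> (line a b c d - V))"
    using open_cofinite_on_line by blast
  then have "finite (line a b c d)" by (rule finite_subset[rotated]) (use UV in blast)
  then show False using infinite_line by blast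
qed

text \<open>
  The list is the reverse of the order in which a connected union grows, so that recursion peels off
  the member that was added last.
\<close>

fun chained :: "('a \<Rightarrow> 'a \<Rightarrow> bool) \<Rightarrow> 'a list \<Rightarrow> bool" where
  "chained R [] = True"
| "chained R (x # xs) \<longleftrightarrow> (xs = [] \<or> (\<exists>y\<in>set xs. R x y)) \<and> chained R xs"

lemma connectedin_chained:
  assumes "chained R xs" "\<And>x. x \<in> set xs \<Longrightarrow> connectedin X (A x)"
    and "\<And>x y. R x y \<Longrightarrow> A x \<inter> A y \<noteq> {}"
  shows "connectedin X (\<Union>x\<in>set xs. A x)"
  using assms(1,2)
proof (induction xs)
  case (Cons x xs)
  show ?case
  proof (cases "xs = []")
    case False
    then have "A x \<inter> (\<Union>y\<in>set xs. A y) \<noteq> {}" using Cons.prems assms(3) by fastforce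
    then show ?thesis using Cons by (simp add: connectedin_Un)
  qed (use Cons.prems in simp)
qed simp

section \<open>Coordinates as pairs of integers\<close>

text \<open>
  A pair \<open>(x, y)\<close> of integers stands for \<open>(x + y \<tau>) / 6\<close>; six is the common denominator of all
  coordinates.
\<close>

type_synonym qint = "int \<times> int"

text \<open>
  The product in \<open>\<int>[\<tau>]\<close>. As the denominators are not multiplied, it represents six times the
  product of the numbers represented by \<open>u\<close> and \<open>v\<close>; this is the factor in \<open>qval_mul\<close>.
\<close>

definition qmul :: "qint \<Rightarrow> qint \<Rightarrow> qint" where
  "qmul u v = (fst u * fst v - 3 * snd u * snd v, fst u * snd v + snd u * fst v)"

definition line_matrices :: "(qint \<times> qint \<times> qint \<times> qint) list" where
  "line_matrices =
  [((6, 0), (0, 0), (0, 0), (6, 0)),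
   ((-6, 0), (0, 0), (0, 0), (-6, 0)),
   ((-6, 0), (0, 0), (0, 0), (3, -3)),
   ((-6, 0), (0, 0), (0, 0), (3, 3)),
   ((6, 0), (0, 0), (0, 0), (-3, -3)),
   ((6, 0), (0, 0), (0, 0), (-3, 3)),
   ((0, -2), (-6, -2), (-3, -1), (3, -1)),
   ((0, -2), (0, 4), (3, -1), (3, -1)),
   ((0, -2), (6, -2), (0, 2), (3, -1)),
   ((0, 2), (-6, 2), (-3, 1), (3, 1)),
   ((0, 2), (0, -4), (3, 1), (3, 1)),
   ((0, 2), (6, 2), (0, -2), (3, 1)),
   ((0, 2), (-6, 2), (3, 1), (0, -2)),
   ((0, 2), (0, -4), (0, -2), (0, -2)),
   ((0, 2), (6, 2), (-3, 1), (0, -2)),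
   ((0, -2), (-6, -2), (3, -1), (0, 2)),
   ((0, -2), (0, 4), (0, 2), (0, 2)),
   ((0, -2), (6, -2), (-3, -1), (0, 2)),
   ((0, -2), (-6, -2), (0, 2), (-3, -1)),
   ((0, -2), (0, 4), (-3, -1), (-3, -1)),
   ((0, -2), (6, -2), (3, -1), (-3, -1)),
   ((0, 2), (-6, 2), (0, -2), (-3, 1)),
   ((0, 2), (0, -4), (-3, 1), (-3, 1)),
   ((0, 2), (6, 2), (3, 1), (-3, 1))]"

definition line_table :: "(nat \<times> qint \<times> qint \<times> qint \<times> qint) list" where
  "line_table = List.enumerate 1 line_matrices"

text \<open>
  The first homogeneous coordinate of every listed point is 1 and is left out.
\<close>

definition point_table :: "((nat \<times> nat \<times> nat) \<times> qint \<times> qint \<times> qint) list" where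
  "point_table =
  [((1, 5, 6), (0, 0), (6, 0), (0, 0)),
   ((1, 7, 10), (-12, 0), (6, 0), (-12, 0)),
   ((1, 8, 12), (6, 6), (6, 0), (6, 6)),
   ((1, 9, 11), (6, -6), (6, 0), (6, -6)),
   ((2, 3, 4), (0, 0), (-6, 0), (0, 0)),
   ((2, 19, 23), (6, 6), (-6, 0), (-6, -6)),
   ((2, 20, 22), (6, -6), (-6, 0), (-6, 6)),
   ((2, 21, 24), (-12, 0), (-6, 0), (12, 0)),
   ((3, 7, 14), (6, -6), (-6, 0), (-6, -6)),
   ((3, 8, 13), (-12, 0), (-6, 0), (-6, 6)),
   ((3, 9, 15), (6, 6), (-6, 0), (12, 0)),
   ((4, 10, 17), (6, 6), (-6, 0), (-6, 6)),
   ((4, 11, 16), (-12, 0), (-6, 0), (-6, -6)),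
   ((4, 12, 18), (6, -6), (-6, 0), (12, 0)),
   ((5, 13, 19), (6, -6), (6, 0), (-12, 0)),
   ((5, 14, 21), (6, 6), (6, 0), (6, -6)),
   ((5, 15, 20), (-12, 0), (6, 0), (6, 6)),
   ((6, 16, 22), (6, 6), (6, 0), (-12, 0)),
   ((6, 17, 24), (6, -6), (6, 0), (6, 6)),
   ((6, 18, 23), (-12, 0), (6, 0), (6, -6)),
   ((7, 16, 19), (0, 0), (0, -2), (-6, -2)),
   ((7, 18, 20), (6, 6), (0, -6), (0, 0)),
   ((8, 16, 21), (6, -6), (0, -6), (0, 0)),
   ((8, 17, 20), (0, 0), (0, -2), (0, 4)),
   ((9, 17, 19), (-12, 0), (0, -6), (0, 0)),
   ((9, 18, 21), (0, 0), (0, -2), (6, -2)),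
   ((10, 13, 22), (0, 0), (0, 2), (-6, 2)),
   ((10, 15, 23), (6, -6), (0, 6), (0, 0)),
   ((11, 13, 24), (6, 6), (0, 6), (0, 0)),
   ((11, 14, 23), (0, 0), (0, 2), (0, -4)),
   ((12, 14, 22), (-12, 0), (0, 6), (0, 0)),
   ((12, 15, 24), (0, 0), (0, 2), (6, 2))]"
definition qval :: "'k::field_char_0 \<Rightarrow> qint \<Rightarrow> 'k" where
  "qval \<tau> u = (of_int (fst u) + of_int (snd u) * \<tau>) / 6"

lemma qval_add: "qval \<tau> (u + v) = qval \<tau> u + qval \<tau> v"
  and qval_diff: "qval \<tau> (u - v) = qval \<tau> u - qval \<tau> v"
  and qval_int: "qval \<tau> (x, 0) = of_int x / 6"
  by (simp_all add: qval_def add_divide_distrib diff_divide_distrib algebra_simps)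

lemma qval_mul:
  assumes "\<tau>^2 = -3"
  shows "qval \<tau> (qmul u v) = 6 * qval \<tau> u * qval \<tau> v"
proof -
  have tau2: "\<tau> * (\<tau> * x) = - (3 * x)" for x
    using assms by (simp add: mult.assoc[symmetric] power2_eq_square)
  show ?thesis by (simp add: qval_def qmul_def field_simps tau2)
qed

text \<open>
  The numbers \<open>1\<close> and \<open>\<tau>\<close> are linearly independent over the integers: \<open>x + y \<tau> = 0\<close> implies
  \<open>x^2 + 3 y^2 = 0\<close>.
\<close>

lemma qval_inject:
  fixes \<tau> :: "'k::field_char_0"
  assumes tau: "\<tau>^2 = -3"
  shows "qval \<tau> u = qval \<tau> v \<longleftrightarrow> u = v"
proof
  assume eq: "qval \<tau> u = qval \<tau> v"
  define x y where "x = fst u - fst v" and "y = snd u - snd v"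
  have "of_int (fst u) + of_int (snd u) * \<tau> = of_int (fst v) + of_int (snd v) * \<tau>"
    using eq unfolding qval_def divide_cancel_right by simp
  then have "of_int x = - (of_int y * \<tau>)"
    by (simp add: x_def y_def algebra_simps)
  then have "(of_int x)^2 = (of_int y)^2 * \<tau>^2" by (simp add: power_mult_distrib)
  then have "(of_int (x^2 + 3 * y^2) :: 'k) = 0" by (simp add: tau)
  then have "x^2 + 3 * y^2 = 0" by (simp only: of_int_eq_0_iff)
  moreover have "x^2 \<ge> 0" "y^2 \<ge> 0" by simp_all
  ultimately have "x^2 = 0" "y^2 = 0" by linarith+
  then show "u = v" by (simp add: x_def y_def prod_eq_iff)
qed simp

lemma L_table:
  assumes "(i, a, b, c, d) \<in> set line_table"
  shows "L \<tau> i = line (qval \<tau> a) (qval \<tau> b) (qval \<tau> c) (qval \<tau> d)"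
proof -
  have "L \<tau> i = map (\<lambda>(a, b, c, d). line (qval \<tau> a) (qval \<tau> b) (qval \<tau> c) (qval \<tau> d))
      line_matrices ! (i - 1)"
    unfolding L_def line_matrices_def
    by (rule arg_cong[where f = "\<lambda>xs. xs ! (i - 1)"])
      (simp add: qval_def line_inject field_simps)
  moreover have "i - 1 < length line_matrices" "line_matrices ! (i - 1) = (a, b, c, d)"
    using assms by (auto simp: line_table_def in_set_enumerate_eq)
  ultimately show ?thesis by simp
qed

lemma fst_line_table: "fst ` set line_table = {1..24}"
proof -
  have "length line_matrices = 24" by (simp add: line_matrices_def)
  then have "map fst line_table = [1..<25]"
    by (simp add: line_table_def)
  then have "fst ` set line_table = {1..<25}" by (metis list.set_map set_upt)
  then show ?thesis by auto
qed

lemma line_tableE: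
  assumes "i \<in> {1..24}"
  obtains a b c d where "(i, a, b, c, d) \<in> set line_table"
  using assms unfolding fst_line_table[symmetric] by auto

lemma triple_points_table:
  "triple_points \<tau> =
    map (\<lambda>(T, x, y, z). (T, point 1 (qval \<tau> x) (qval \<tau> y) (qval \<tau> z))) point_table"
  unfolding triple_points_def point_table_def
  by (simp add: qval_def point_eq_iff field_simps)

text \<open>
  The incidence conditions \<open>y = a + c x\<close> and \<open>z = b + d x\<close> of \<open>point_in_line\<close>; multiplication by
  \<open>(6, 0)\<close>, the number 1, gives all terms the same scaling.
\<close>

definition qincident :: "qint \<times> qint \<times> qint \<times> qint \<Rightarrow> qint \<times> qint \<times> qint \<Rightarrow> bool" where
  "qincident = (\<lambda>(a, b, c, d) (x, y, z).
     qmul (6, 0) y = qmul (6, 0) a + qmul c x \<and> qmul (6, 0) z = qmul (6, 0) b + qmul d x)"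

lemma qincident_iff:
  assumes tau: "\<tau>^2 = -3" and "(i, m) \<in> set line_table"
  shows "qincident m (x, y, z) \<longleftrightarrow> point 1 (qval \<tau> x) (qval \<tau> y) (qval \<tau> z) \<in> L \<tau> i"
proof -
  obtain a b c d where m: "m = (a, b, c, d)" by (cases m)
  have "qincident m (x, y, z) \<longleftrightarrow>
      6 * qval \<tau> y = 6 * (qval \<tau> a + qval \<tau> c * qval \<tau> x) \<and>
      6 * qval \<tau> z = 6 * (qval \<tau> b + qval \<tau> d * qval \<tau> x)"
    unfolding m qincident_def
    by (simp add: qval_inject[OF tau, symmetric] qval_mul[OF tau] qval_add qval_int algebra_simps)
  also have "\<dots> \<longleftrightarrow> point 1 (qval \<tau> x) (qval \<tau> y) (qval \<tau> z) \<in> L \<tau> i"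
    using assms(2) unfolding m by (simp add: L_table point_in_line del: distrib_left_numeral)
  finally show ?thesis .
qed

text \<open>
  The coefficients in \<open>line_in_quartic\<close>. Each monomial is a fourfold \<open>qmul\<close> product and hence carries
  the factor \<open>6^3 = 216\<close>, so that a coefficient 1 appears as \<open>216 = 1296 / 6\<close>, the pair
  \<open>(1296, 0)\<close>. The outer product with \<open>(n, 0)\<close>, the number \<open>n / 6\<close>, multiplies by \<open>n\<close>.
\<close>

definition qform_coeffs :: "qint \<times> qint \<times> qint \<times> qint \<Rightarrow> qint list" where
  "qform_coeffs = (\<lambda>(a, b, c, d). let m = (\<lambda>n p q r s. qmul (n, 0) (qmul (qmul p q) (qmul r s))) in
     [m 1 a a a a - m 1 a b b b,
      m 4 a a a c - m 3 a b b d - m 1 c b b b,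
      m 6 a a c c - m 3 a b d d - m 3 c b b d,
      m 4 a c c c - m 1 a d d d - m 3 c b d d,
      m 1 c c c c - m 1 c d d d])"

section \<open>Verification of the tables\<close>

lemma check_quartic:
  "\<forall>(i, m) \<in> set line_table. qform_coeffs m = [(1296, 0), (0, 0), (0, 0), (-1296, 0), (0, 0)]"
  by code_simp

lemma check_distinct_lines: "distinct line_matrices"
  by code_simp

lemma check_distinct_points: "distinct (map snd point_table)"
  by code_simp

lemma check_incidence:
  "\<forall>((j, k, l), p) \<in> set point_table.
    map fst (filter (\<lambda>(i, m). qincident m p) line_table) = [j, k, l]"
  by code_simp

lemma check_triples: "\<forall>((j, k, l), p) \<in> set point_table. j < k \<and> k < l"
  by code_simp

lemma check_four: "\<forall>i \<in> fst ` set line_table.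
    length (filter (\<lambda>(j, k, l). i \<in> {j, k, l}) (map fst point_table)) = 4"
  by code_simp

definition in_common_triple :: "nat \<Rightarrow> nat \<Rightarrow> bool" where
  "in_common_triple i i' \<longleftrightarrow> (\<exists>(j, k, l) \<in> fst ` set point_table. {i, i'} \<subseteq> {j, k, l})"

text \<open>
  The equation says that the difference of the two matrices has determinant zero, since \<open>qmul\<close>
  scales both products by the same factor.
\<close>

lemma check_det:
  "\<forall>(i, a, b, c, d) \<in> set line_table. \<forall>(i', a', b', c', d') \<in> set line_table.
    qmul (a - a') (d - d') = qmul (b - b') (c - c') \<longrightarrow> i = i' \<or> in_common_triple i i'"
  by code_simp

text \<open>
  From line 1 the lines 5 to 12 are reached, through lines 5 and 6 the lines 13 to 24, and then lines
  3 and 4 through lines 7 and 10, and line 2 through line 3.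
\<close>

lemma check_chain: "chained in_common_triple ([2, 4, 3] @ rev [5..<25] @ [1])"
  by code_simp

section \<open>The divisor\<close>

lemma keys_sum_single_1:
  assumes "finite A"
  shows "Poly_Mapping.keys (\<Sum>j\<in>A. Poly_Mapping.single (f j) (1::int)) = f ` A"
proof -
  have "Poly_Mapping.lookup (\<Sum>j\<in>A. Poly_Mapping.single (f j) (1::int)) C = 0
      \<longleftrightarrow> (\<forall>j\<in>A. f j \<noteq> C)" for C
    \<comment> \<open>The multiplicities are not negative, so they cannot cancel even if \<open>f\<close> is not injective.\<close>
    unfolding lookup_sum lookup_single when_def
    using assms by (subst sum_nonneg_eq_0_iff) auto
  then show ?thesis unfolding set_eq_iff in_keys_iff image_iff by blast
qed

context
  fixes \<tau> :: "'k::field_char_0"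
  assumes tau: "\<tau>^2 = -3"
begin

lemma incident_lines:
  assumes "((j, k, l), p) \<in> set (triple_points \<tau>)"
  shows "{i \<in> {1..24}. p \<in> L \<tau> i} = {j, k, l}"
proof -
  obtain x y z where xyz: "((j, k, l), x, y, z) \<in> set point_table"
      and p: "p = point 1 (qval \<tau> x) (qval \<tau> y) (qval \<tau> z)"
    using assms unfolding triple_points_table by auto
  have "{i \<in> {1..24}. p \<in> L \<tau> i} = fst ` {(i, m) \<in> set line_table. p \<in> L \<tau> i}"
    unfolding fst_line_table[symmetric] by force
  also have "\<dots> = fst ` {(i, m) \<in> set line_table. qincident m (x, y, z)}"
    unfolding p using qincident_iff[OF tau] by (intro arg_cong[where f = "image fst"]) blast
  also have "\<dots> = set (map fst (filter (\<lambda>(i, m). qincident m (x, y, z)) line_table))"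
    by (simp add: case_prod_unfold)
  also have "\<dots> = {j, k, l}" using check_incidence xyz by fastforce
  finally show ?thesis .
qed

lemma common_triple_iff:
  "in_common_triple i i' \<longleftrightarrow> (\<exists>((j, k, l), p) \<in> set (triple_points \<tau>). {i, i'} \<subseteq> {j, k, l})"
  unfolding in_common_triple_def triple_points_table by force

lemma inj_on_L: "inj_on (L \<tau>) {1..24}"
proof
  fix i i' :: nat assume "i \<in> {1..24}" "i' \<in> {1..24}" and eq: "L \<tau> i = L \<tau> i'"
  then obtain a b c d a' b' c' d' where m: "(i, a, b, c, d) \<in> set line_table"
      "(i', a', b', c', d') \<in> set line_table" by (meson line_tableE)
  with eq have "(a, b, c, d) = (a', b', c', d')"
    by (simp add: L_table line_inject qval_inject[OF tau])
  then have "line_matrices ! (i - 1) = line_matrices ! (i' - 1)"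
    and "i - 1 < length line_matrices" "i' - 1 < length line_matrices" "1 \<le> i" "1 \<le> i'"
    using m unfolding line_table_def in_set_enumerate_eq by auto
  then show "i = i'"
    using nth_eq_iff_index_eq[OF check_distinct_lines] by (metis le_add_diff_inverse)
qed

lemma lines_skew:
  assumes "i \<in> {1..24}" "i' \<in> {1..24}" "i \<noteq> i'" "\<not> in_common_triple i i'"
  shows "skew (L \<tau> i) (L \<tau> i')"
proof -
  obtain a b c d a' b' c' d' where m: "(i, a, b, c, d) \<in> set line_table"
      "(i', a', b', c', d') \<in> set line_table" using assms(1,2) by (meson line_tableE)
  then have "qmul (a - a') (d - d') \<noteq> qmul (b - b') (c - c')" using check_det assms(3,4) by fast
  then have "qval \<tau> (qmul (a - a') (d - d')) \<noteq> qval \<tau> (qmul (b - b') (c - c'))"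
    by (simp add: qval_inject[OF tau])
  then show ?thesis unfolding m[THEN L_table] qval_mul[OF tau] qval_diff mult.assoc
    by (intro skewI) simp
qed

lemma L_meet_once:
  assumes "i \<in> {1..24}" "i' \<in> {1..24}" "i \<noteq> i'" "p \<in> L \<tau> i" "p \<in> L \<tau> i'" "q \<in> L \<tau> i" "q \<in> L \<tau> i'"
  shows "p = q"
proof -
  obtain a b c d a' b' c' d' where m: "(i, a, b, c, d) \<in> set line_table"
      "(i', a', b', c', d') \<in> set line_table" using assms(1,2) by (meson line_tableE)
  have "L \<tau> i \<noteq> L \<tau> i'" using inj_on_eq_iff[OF inj_on_L assms(1,2)] assms(3) by simp
  then show ?thesis using assms(4-7) unfolding m[THEN L_table] by (rule distinct_lines_meet_once)
qed

lemma keys_D: "Poly_Mapping.keys (D \<tau>) = L \<tau> ` {1..24}"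
  unfolding D_def by (intro keys_sum_single_1) simp

text \<open>
  If \<open>p\<close> lies on two lines, these are not skew and so occur in a common triple. The point listed
  with it lies on both lines as well, and two lines share one point only.
\<close>

lemma sing_locus_D: "sing_locus (D \<tau>) = snd ` set (triple_points \<tau>)"
proof (intro set_eqI iffI)
  fix p assume "p \<in> sing_locus (D \<tau>)"
  then obtain i i' where i: "i \<in> {1..24}" "i' \<in> {1..24}" "i \<noteq> i'" "p \<in> L \<tau> i" "p \<in> L \<tau> i'"
    unfolding sing_locus_def keys_D by blast
  then have "in_common_triple i i'" using lines_skew unfolding skew_def by blast
  then obtain j k l q where q: "((j, k, l), q) \<in> set (triple_points \<tau>)" "{i, i'} \<subseteq> {j, k, l}"
    unfolding common_triple_iff by blast
  then have "q \<in> L \<tau> i" "q \<in> L \<tau> i'" using incident_lines[OF q(1)] by blast+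
  then have "p = q" using L_meet_once i by blast
  then show "p \<in> snd ` set (triple_points \<tau>)" using q(1) by force
next
  fix p assume "p \<in> snd ` set (triple_points \<tau>)"
  then obtain j k l where T: "((j, k, l), p) \<in> set (triple_points \<tau>)" by auto
  then have "j < k" using check_triples unfolding triple_points_table by fastforce
  have "j \<in> {1..24}" "k \<in> {1..24}" "p \<in> L \<tau> j" "p \<in> L \<tau> k"
    using incident_lines[OF T] by blast+
  moreover from this have "L \<tau> j \<noteq> L \<tau> k" using inj_on_eq_iff[OF inj_on_L, of j k] \<open>j < k\<close> by simp
  ultimately show "p \<in> sing_locus (D \<tau>)" unfolding sing_locus_def keys_D by blast
qed

lemma distinct_triple_points: "distinct (map snd (triple_points \<tau>))"
proof -
  let ?pt = "\<lambda>(x, y, z). point 1 (qval \<tau> x) (qval \<tau> y) (qval \<tau> z)"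
  have "inj ?pt" unfolding inj_def by (clarsimp simp: point_eq_iff qval_inject[OF tau])
  then have "inj_on ?pt (set (map snd point_table))" by (rule inj_on_subset) simp
  with check_distinct_points have "distinct (map ?pt (map snd point_table))"
    unfolding distinct_map[of ?pt] by (rule conjI)
  moreover have "map snd (triple_points \<tau>) = map ?pt (map snd point_table)"
    unfolding triple_points_table map_map by (intro map_cong) (auto simp: o_def)
  ultimately show ?thesis by (simp only:)
qed

text \<open>
  By \<open>incident_lines\<close> the points on line \<open>i\<close> are those listed with a triple that contains \<open>i\<close>, so it
  suffices to count triples.
\<close>

lemma four_points:
  assumes "i \<in> {1..24}"
  shows "card {p \<in> snd ` set (triple_points \<tau>). p \<in> L \<tau> i} = 4"
proof -
  let ?P = "\<lambda>(j, k, l). i \<in> {j, k, l}"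
  let ?ps = "filter (?P \<circ> fst) (triple_points \<tau>)"
  have iff: "snd e \<in> L \<tau> i \<longleftrightarrow> ?P (fst e)" if "e \<in> set (triple_points \<tau>)" for e
  proof -
    obtain j k l p where e: "e = ((j, k, l), p)" by (metis prod.exhaust)
    from incident_lines[OF that[unfolded e]] assms have "p \<in> L \<tau> i \<longleftrightarrow> i \<in> {j, k, l}" by blast
    then show ?thesis unfolding e by simp
  qed
  have "{e \<in> set (triple_points \<tau>). snd e \<in> L \<tau> i} = set ?ps"
    unfolding set_filter comp_apply by (rule Collect_cong) (simp only: iff cong: conj_cong)
  then have "{p \<in> snd ` set (triple_points \<tau>). p \<in> L \<tau> i} = set (map snd ?ps)"
    unfolding set_map by blast
  moreover have "distinct (map snd ?ps)" using distinct_triple_points by (rule distinct_map_filter)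
  ultimately have "card {p \<in> snd ` set (triple_points \<tau>). p \<in> L \<tau> i} = length ?ps"
    by (simp only: distinct_card length_map)
  also have "length ?ps = length (filter ?P (map fst (triple_points \<tau>)))"
    by (simp only: filter_map length_map)
  also have "map fst (triple_points \<tau>) = map fst point_table"
    unfolding triple_points_table map_map by (intro map_cong) auto
  also have "length (filter ?P (map fst point_table)) = 4"
    using check_four assms unfolding fst_line_table by (rule bspec)
  finally show ?thesis .
qed

lemma L_in_quartic:
  assumes "i \<in> {1..24}"
  shows "L \<tau> i \<subseteq> quartic"
proof -
  obtain a b c d where m: "(i, a, b, c, d) \<in> set line_table" using assms by (rule line_tableE)
  have m4: "qval \<tau> (qmul (n, 0) (qmul (qmul p q) (qmul r s)))
      = of_int n * (216 * (qval \<tau> p * qval \<tau> q * qval \<tau> r * qval \<tau> s))" for n p q r s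
    by (simp add: qval_mul[OF tau] qval_int)
  let ?a = "qval \<tau> a" and ?b = "qval \<tau> b" and ?c = "qval \<tau> c" and ?d = "qval \<tau> d"
  have "map (qval \<tau>) (qform_coeffs (a, b, c, d))
      = map (qval \<tau>) [(1296, 0), (0, 0), (0, 0), (-1296, 0), (0, 0)]"
    using check_quartic m by fastforce
  then have "216 * (?a^4 - ?a * ?b^3) = 216 * 1"
    "216 * (4 * ?a^3 * ?c - 3 * ?a * ?b^2 * ?d - ?c * ?b^3) = 216 * 0"
    "216 * (6 * ?a^2 * ?c^2 - 3 * ?a * ?b * ?d^2 - 3 * ?c * ?b^2 * ?d) = 216 * 0"
    "216 * (4 * ?a * ?c^3 - ?a * ?d^3 - 3 * ?c * ?b * ?d^2) = 216 * (-1)"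
    "216 * (?c^4 - ?c * ?d^3) = 216 * 0"
    unfolding qform_coeffs_def prod.case Let_def list.map qval_diff m4 list.inject
    by (simp_all add: qval_int power4_eq_xxxx power3_eq_cube power2_eq_square algebra_simps)
  then show ?thesis
    unfolding m[THEN L_table] by (intro line_in_quartic) (simp_all only: mult_cancel_left, simp_all)
qed

lemma connected_D: "connected_divisor (D \<tau>)"
proof -
  let ?order = "[2, 4, 3] @ rev [5..<25] @ [1]"
  have order: "set ?order = {1..24}"
    unfolding set_append set_rev set_upt list.set by auto
  have "connectedin zariski (\<Union>i\<in>set ?order. L \<tau> i)"
  proof (rule connectedin_chained[OF check_chain])
    fix i assume "i \<in> set ?order"
    then obtain a b c d where "(i, a, b, c, d) \<in> set line_table" unfolding order by (rule line_tableE)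
    then show "connectedin zariski (L \<tau> i)" by (simp add: L_table connectedin_line)
  next
    fix i i' assume "in_common_triple i i'"
    then obtain j k l q where q: "((j, k, l), q) \<in> set (triple_points \<tau>)" "{i, i'} \<subseteq> {j, k, l}"
      unfolding common_triple_iff by blast
    then show "L \<tau> i \<inter> L \<tau> i' \<noteq> {}" using incident_lines[OF q(1)] by blast
  qed
  then show ?thesis unfolding connected_divisor_def support_def keys_D order .
qed

lemma transverse_D: "transverse_at (D \<tau>) p"
  unfolding transverse_at_def keys_D
proof (rule pairwiseI; clarify)
  fix i i' :: nat
  assume i: "i \<in> {1..24}" "i' \<in> {1..24}" "p \<in> L \<tau> i" "p \<in> L \<tau> i'" "L \<tau> i \<noteq> L \<tau> i'"
    and eq: "tangent_space (L \<tau> i) p = tangent_space (L \<tau> i') p"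
  obtain a b c d a' b' c' d' where m: "(i, a, b, c, d) \<in> set line_table"
      "(i', a', b', c', d') \<in> set line_table" using i(1,2) by (meson line_tableE)
  show False using i(3-5) eq unfolding m[THEN L_table]
    by (simp add: tangent_space_line) (simp add: line_eq)
qed

end

theorem proposition3p5:
  fixes \<tau> :: "'k::field_char_0"
  assumes tau: "\<tau>^2 = -3"
    and K: "rat_adjoin \<tau> = (UNIV :: 'k set)"
  shows "(\<forall>j\<in>{1..24}. L \<tau> j \<subseteq> quartic)
    \<and> sing_locus (D \<tau>) = snd ` set (triple_points \<tau>)
    \<and> (\<forall>((j, k, l), p) \<in> set (triple_points \<tau>). {i \<in> {1..24}. p \<in> L \<tau> i} = {j, k, l})
    \<and> length (triple_points \<tau>) = 32
    \<and> distinct (map snd (triple_points \<tau>))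
    \<and> (\<forall>i\<in>{1..24}. \<forall>i'\<in>{1..24}. i \<noteq> i' \<and>
         \<not> (\<exists>((j, k, l), p) \<in> set (triple_points \<tau>). {i, i'} \<subseteq> {j, k, l}) \<longrightarrow>
         skew (L \<tau> i) (L \<tau> i'))
    \<and> (\<forall>j\<in>{1..24}. card {p \<in> snd ` set (triple_points \<tau>). p \<in> L \<tau> j} = 4)
    \<and> connected_divisor (D \<tau>)
    \<and> (\<forall>p\<in>sing_locus (D \<tau>). transverse_at (D \<tau>) p)"
proof (intro conjI)
  show "\<forall>((j, k, l), p) \<in> set (triple_points \<tau>). {i \<in> {1..24}. p \<in> L \<tau> i} = {j, k, l}"
    using incident_lines[OF tau] by blast
  show "length (triple_points \<tau>) = 32" by (simp add: triple_points_def)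
  show "\<forall>i\<in>{1..24}. \<forall>i'\<in>{1..24}. i \<noteq> i' \<and>
      \<not> (\<exists>((j, k, l), p) \<in> set (triple_points \<tau>). {i, i'} \<subseteq> {j, k, l}) \<longrightarrow>
      skew (L \<tau> i) (L \<tau> i')"
    using lines_skew[OF tau] unfolding common_triple_iff[OF tau] by blast
qed (simp_all add: L_in_quartic[OF tau] sing_locus_D[OF tau] distinct_triple_points[OF tau]
    four_points[OF tau] connected_D[OF tau] transverse_D[OF tau])

end
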